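(* Let $\Bbbk$ be a field and let $A$ and $B$ be two connected graded Poisson algebras over $\Bbbk$, each finitely generated in degree one. If $A\cong B$ as ungraded Poisson algebras, then $A\cong B$ as graded Poisson algebras.
   Context: A Poisson algebra over a field $\Bbbk$ is a commutative $\Bbbk$-algebra $A$ with a $\Bbbk$-bilinear bracket $\{\,,\}$ making $A$ a Lie algebra and such that $\{a,-\}$ is a $\Bbbk$-derivation of $A$ for every $a\in A$. An isomorphism of (ungraded) Poisson algebras is a bijective $\Bbbk$-algebra homomorphism preserving brackets. A Poisson algebra is $\mathbb N$-graded if $A=\bigoplus_{i\ge 0}A_i$ with $A_iA_j\subseteq A_{i+j}$ and $\{A_i,A_j\}\subseteq A_{i+j}$ for all $i,j\ge 0$; it is connected graded if moreover $A_0=\Bbbk$. It is finitely generated in degree one if it is generated as a $\Bbbk$-algebra by $A_1$ and $\dim_\Bbbk A_1<\infty$. An isomorphism of graded Poisson algebras is a Poisson algebra isomorphism $\psi:A\to B$ with $\psi(A_i)=B_i$ for all $i$. *)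

theory Defs
  imports Complex_Main
begin

text \<open>
  Algebras occupy a whole type: the underlying commutative unital ring is given by the type class
  and the \<open>\<k>\<close>-action by an explicit scalar multiplication, as in \<^locale>\<open>vector_space\<close>.
  The class \<^class>\<open>comm_ring_1\<close> includes \<open>0 \<noteq> 1\<close>; this excludes only the zero algebra, which
  is not connected graded.
\<close>

locale comm_algebra = vector_space scale
  for scale :: "'k::field \<Rightarrow> 'a::comm_ring_1 \<Rightarrow> 'a" +
  assumes scale_mult_left: "scale c x * y = scale c (x * y)"
begin

definition subalgebra :: "'a set \<Rightarrow> bool" where
  "subalgebra S \<longleftrightarrow> subspace S \<and> 1 \<in> S \<and> (\<forall>x\<in>S. \<forall>y\<in>S. x * y \<in> S)"

definition derivation :: "('a \<Rightarrow> 'a) \<Rightarrow> bool" where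
  "derivation D \<longleftrightarrow>
     Vector_Spaces.linear scale scale D \<and> (\<forall>x y. D (x * y) = D x * y + x * D y)"

end

text \<open>The field has arbitrary characteristic, so the Lie bracket is required to be alternating.\<close>

locale poisson_algebra = comm_algebra scale
  for scale :: "'k::field \<Rightarrow> 'a::comm_ring_1 \<Rightarrow> 'a" +
  fixes bracket :: "'a \<Rightarrow> 'a \<Rightarrow> 'a"
  assumes bracket_linear_left: "Vector_Spaces.linear scale scale (\<lambda>x. bracket x y)"
    and bracket_linear_right: "Vector_Spaces.linear scale scale (\<lambda>y. bracket x y)"
    and bracket_self: "bracket x x = 0"
    and jacobi: "bracket x (bracket y z) + bracket y (bracket z x) + bracket z (bracket x y) = 0"
    and bracket_derivation: "derivation (bracket x)"

locale graded_poisson_algebra = poisson_algebra scale bracket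
  for scale :: "'k::field \<Rightarrow> 'a::comm_ring_1 \<Rightarrow> 'a"
    and bracket :: "'a \<Rightarrow> 'a \<Rightarrow> 'a" +
  fixes gr :: "nat \<Rightarrow> 'a set"
  assumes gr_subspace: "subspace (gr i)"
    and gr_direct_sum: "\<exists>!f :: nat \<Rightarrow> 'a.
          (\<forall>i. f i \<in> gr i) \<and> finite {i. f i \<noteq> 0} \<and> x = (\<Sum>i | f i \<noteq> 0. f i)"
    and gr_mult: "x \<in> gr i \<Longrightarrow> y \<in> gr j \<Longrightarrow> x * y \<in> gr (i + j)"
    and gr_bracket: "x \<in> gr i \<Longrightarrow> y \<in> gr j \<Longrightarrow> bracket x y \<in> gr (i + j)"
begin

definition fin_gen_in_degree_one :: bool where
  "fin_gen_in_degree_one \<longleftrightarrow>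
     subalgebra hull (gr 1) = UNIV \<and> (\<exists>B. finite B \<and> span B = gr 1)"

end

text \<open>The equation \<open>A\<^sub>0 = \<k>\<close> identifies \<open>\<k>\<close> with its image under \<open>c \<mapsto> c \<cdot> 1\<close>.\<close>

locale connected_graded_poisson_algebra = graded_poisson_algebra scale bracket gr
  for scale :: "'k::field \<Rightarrow> 'a::comm_ring_1 \<Rightarrow> 'a"
    and bracket :: "'a \<Rightarrow> 'a \<Rightarrow> 'a"
    and gr :: "nat \<Rightarrow> 'a set" +
  assumes gr_0: "gr 0 = range (\<lambda>c. scale c 1)"

definition poisson_iso ::
  "('k::field \<Rightarrow> 'a::comm_ring_1 \<Rightarrow> 'a) \<Rightarrow> ('a \<Rightarrow> 'a \<Rightarrow> 'a) \<Rightarrow>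
   ('k \<Rightarrow> 'b::comm_ring_1 \<Rightarrow> 'b) \<Rightarrow> ('b \<Rightarrow> 'b \<Rightarrow> 'b) \<Rightarrow> ('a \<Rightarrow> 'b) \<Rightarrow> bool" where
  "poisson_iso scaleA bracketA scaleB bracketB \<phi> \<longleftrightarrow>
     Vector_Spaces.linear scaleA scaleB \<phi> \<and> bij \<phi> \<and>
     \<phi> 1 = 1 \<and> (\<forall>x y. \<phi> (x * y) = \<phi> x * \<phi> y) \<and>
     (\<forall>x y. \<phi> (bracketA x y) = bracketB (\<phi> x) (\<phi> y))"

definition graded_poisson_iso ::
  "('k::field \<Rightarrow> 'a::comm_ring_1 \<Rightarrow> 'a) \<Rightarrow> ('a \<Rightarrow> 'a \<Rightarrow> 'a) \<Rightarrow> (nat \<Rightarrow> 'a set) \<Rightarrow>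
   ('k \<Rightarrow> 'b::comm_ring_1 \<Rightarrow> 'b) \<Rightarrow> ('b \<Rightarrow> 'b \<Rightarrow> 'b) \<Rightarrow> (nat \<Rightarrow> 'b set) \<Rightarrow>
   ('a \<Rightarrow> 'b) \<Rightarrow> bool" where
  "graded_poisson_iso scaleA bracketA grA scaleB bracketB grB \<psi> \<longleftrightarrow>
     poisson_iso scaleA bracketA scaleB bracketB \<psi> \<and> (\<forall>i. \<psi> ` grA i = grB i)"

end

theory Submission
  imports Defs
begin

text \<open>
  An ungraded isomorphism \<open>\<phi> : A \<rightarrow> B\<close> need not send the ideal \<open>A\<^sub>\<ge>\<^sub>1\<close> to \<open>B\<^sub>\<ge>\<^sub>1\<close>: it may add
  constants to the generators. So one cannot simply take lowest-degree parts of \<open>\<phi>\<close>. What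
  works is to compare the ascending degree filtration of \<open>A\<close> with the descending degree
  filtration of \<open>B\<close>, pulled back along \<open>\<phi>\<close>. Write \<open>A\<^sub><\<^sub>d\<close> (\<open>below d\<close>) for the elements of degree
  less than \<open>d\<close> and \<open>B\<^sub>\<ge>\<^sub>d\<close> (\<open>above d\<close>) for those without components below \<open>d\<close>. The key fact is
    \<open>A = A\<^sub><\<^sub>d \<oplus> \<phi>\<^sup>-\<^sup>1(B\<^sub>\<ge>\<^sub>d)\<close> for every \<open>d\<close>.

  The sum is everything (\<open>below_plus_above\<close>): let \<open>W\<^sub>d = A\<^sub>\<le>\<^sub>d \<inter> \<phi>\<^sup>-\<^sup>1(B\<^sub>\<ge>\<^sub>d)\<close> (\<open>bridge d\<close>). Subtracting
  from \<open>x \<in> A\<^sub>1\<close> the constant term of \<open>\<phi> x\<close> gives an element of \<open>W\<^sub>1\<close>, so the \<open>W\<^sub>n\<close>, whose span is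
  a subalgebra, span \<open>A\<close>; and each \<open>W\<^sub>n\<close> lies in \<open>A\<^sub><\<^sub>d\<close> or in \<open>\<phi>\<^sup>-\<^sup>1(B\<^sub>\<ge>\<^sub>d)\<close>. The sum is direct
  (\<open>below_inter_above\<close>) by a dimension count: since the sum is everything, \<open>A\<^sub><\<^sub>d\<close> maps onto
  \<open>B / B\<^sub>\<ge>\<^sub>d\<close>, which is isomorphic to \<open>B\<^sub><\<^sub>d\<close>; the same argument for the inverse of \<open>\<phi>\<close> gives the
  reverse inequality of these finite dimensions, so the surjection is injective.

  It follows formally that taking the top component identifies \<open>W\<^sub>d\<close> with \<open>A\<^sub>d\<close>, and that taking the
  lowest component of the image under \<open>\<phi>\<close> identifies \<open>W\<^sub>d\<close> with \<open>B\<^sub>d\<close>. Both kinds of leading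
  component are compatible with products and with brackets, because both operations are bilinear
  and additive in degrees and \<open>W\<^sub>i\<close>, \<open>W\<^sub>j\<close> multiply and bracket into \<open>W\<^sub>i\<^sub>+\<^sub>j\<close>. The composites
  \<open>A\<^sub>d \<rightarrow> W\<^sub>d \<rightarrow> B\<^sub>d\<close> therefore glue to a graded Poisson isomorphism (\<open>graded_poisson_iso_glue\<close>).
\<close>

section \<open>Linear algebra\<close>

text \<open>
  Extending a nonzero kernel vector to a basis of \<open>S\<close> wastes one basis vector. Read backwards, a
  surjection between spaces of equal finite dimension is injective; the formulation with an image
  fits maps between two spaces that are not themselves finite-dimensional.
\<close>

lemma dim_image_less_of_kernel:
  assumes lin: "Vector_Spaces.linear s1 s2 f"
    and fin: "S \<subseteq> module.span s1 M" "finite M"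
    and x: "x \<in> S" "f x = 0" "x \<noteq> 0"
  shows "vector_space.dim s2 (f ` S) < vector_space.dim s1 S"
proof -
  interpret Vector_Spaces.linear s1 s2 f by (rule lin)
  have "vs1.independent {x}"
    using x by simp
  then obtain C where C: "{x} \<subseteq> C" "C \<subseteq> S" "vs1.independent C" "S \<subseteq> vs1.span C"
    using vs1.maximal_independent_subset_extend[of "{x}" S] x by blast
  have finC: "finite C"
    using vs1.independent_span_bound[OF fin(2) C(3)] C(2) fin(1) by blast
  have "f ` S \<subseteq> f ` vs1.span C"
    using C(4) by blast
  also have "\<dots> = vs2.span (f ` C)"
    by (simp add: span_image)
  also have "f ` C = insert 0 (f ` (C - {x}))"
    using C(1) x(2) by auto
  also have "vs2.span (insert 0 (f ` (C - {x}))) = vs2.span (f ` (C - {x}))"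
    by (rule vs2.span_insert_0)
  finally have "vs2.dim (f ` S) \<le> card (f ` (C - {x}))"
    using finC by (intro vs2.dim_le_card) auto
  also have "\<dots> \<le> card (C - {x})"
    using finC by (intro card_image_le) auto
  also have "\<dots> < card C"
    using finC C(1) by (intro psubset_card_mono) auto
  also have "card C = vs1.dim S"
    using vs1.basis_card_eq_dim[OF C(2) C(4) C(3)] by simp
  finally show ?thesis .
qed

lemma dim_image_le:
  assumes lin: "Vector_Spaces.linear s1 s2 f"
    and fin: "S \<subseteq> module.span s1 M" "finite M"
  shows "vector_space.dim s2 (f ` S) \<le> vector_space.dim s1 S"
proof -
  interpret Vector_Spaces.linear s1 s2 f by (rule lin)
  obtain C where C: "C \<subseteq> S" "vs1.independent C" "S \<subseteq> vs1.span C" "card C = vs1.dim S"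
    using vs1.basis_exists by blast
  have finC: "finite C"
    using vs1.independent_span_bound[OF fin(2) C(2)] C(1) fin(1) by blast
  have "f ` S \<subseteq> vs2.span (f ` C)"
    unfolding span_image by (rule image_mono[OF C(3)])
  then have "vs2.dim (f ` S) \<le> card (f ` C)"
    using finC by (intro vs2.dim_le_card) auto
  also have "\<dots> \<le> card C"
    using finC by (rule card_image_le)
  finally show ?thesis
    using C(4) by simp
qed

lemma (in comm_algebra) subalgebra_span:
  assumes "1 \<in> M" and mult: "\<And>x y. x \<in> M \<Longrightarrow> y \<in> M \<Longrightarrow> x * y \<in> M"
  shows "subalgebra (span M)"
proof -
  have scale_mult_right: "x * scale c y = scale c (x * y)" for c x y
    by (metis mult.commute scale_mult_left)
  have 1: "x * y \<in> span M" if "x \<in> M" "y \<in> span M" for x y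
    using that(2)
    by (induction rule: span_induct_alt)
       (simp_all add: span_zero distrib_left scale_mult_right span_add span_scale span_base mult that(1))
  have "x * y \<in> span M" if "x \<in> span M" "y \<in> span M" for x y
    using that(1)
    by (induction rule: span_induct_alt)
       (simp_all add: span_zero distrib_right scale_mult_left span_add span_scale 1 that(2))
  then show ?thesis
    unfolding subalgebra_def using assms(1) by (auto intro: span_base)
qed

section \<open>Homogeneous components\<close>

context graded_poisson_algebra
begin

definition component :: "nat \<Rightarrow> 'a \<Rightarrow> 'a" where
  "component i x = (THE f. (\<forall>i. f i \<in> gr i) \<and> finite {i. f i \<noteq> 0} \<and> x = (\<Sum>i | f i \<noteq> 0. f i)) i"

definition below :: "nat \<Rightarrow> 'a set" where
  "below d = {x. \<forall>i\<ge>d. component i x = 0}"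

definition above :: "nat \<Rightarrow> 'a set" where
  "above d = {x. \<forall>i<d. component i x = 0}"

lemma component_decomposition:
  "(\<forall>i. component i x \<in> gr i) \<and> finite {i. component i x \<noteq> 0}
    \<and> x = (\<Sum>i | component i x \<noteq> 0. component i x)"
  using theI'[OF gr_direct_sum[of x]] unfolding component_def by simp

lemma component_in_gr [simp, intro]: "component i x \<in> gr i"
  using component_decomposition by blast

lemma component_eqI:
  assumes gr: "\<And>i. f i \<in> gr i" and J: "finite J" "\<And>i. i \<notin> J \<Longrightarrow> f i = 0"
    and x: "x = (\<Sum>i\<in>J. f i)"
  shows "component i x = f i"
proof -
  have sub: "{i. f i \<noteq> 0} \<subseteq> J"
    using J(2) by blast
  have "x = (\<Sum>i | f i \<noteq> 0. f i)"
    unfolding x using sub by (intro sum.mono_neutral_right J(1)) auto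
  then have "(THE f. (\<forall>i. f i \<in> gr i) \<and> finite {i. f i \<noteq> 0} \<and> x = (\<Sum>i | f i \<noteq> 0. f i)) = f"
    by (intro the1_equality[OF gr_direct_sum] conjI allI gr finite_subset[OF sub J(1)])
  then show ?thesis
    unfolding component_def by simp
qed

lemma zero_in_gr [simp]: "0 \<in> gr i"
  by (rule subspace_0[OF gr_subspace])

lemma component_homogeneous:
  assumes "x \<in> gr j"
  shows "component i x = (if i = j then x else 0)"
  by (rule component_eqI[where f = "\<lambda>i. if i = j then x else 0" and J = "{j}"]) (use assms in auto)

lemma ex_below: "\<exists>N\<ge>n. x \<in> below N"
proof -
  have "finite {i. component i x \<noteq> 0}"
    using component_decomposition by blast
  then obtain N where "\<forall>i\<in>{i. component i x \<noteq> 0}. i < N"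
    unfolding finite_nat_set_iff_bounded by blast
  then have "x \<in> below (max n N)"
    by (force simp: below_def)
  then show ?thesis
    using max.cobounded1 by blast
qed

lemma below_mono: "x \<in> below d \<Longrightarrow> d \<le> e \<Longrightarrow> x \<in> below e"
  by (auto simp: below_def)

lemma sum_components:
  assumes "x \<in> below N"
  shows "(\<Sum>i<N. component i x) = x"
proof -
  have "(\<Sum>i | component i x \<noteq> 0. component i x) = (\<Sum>i<N. component i x)"
    by (rule sum.mono_neutral_left) (use assms in \<open>auto simp: below_def not_le[symmetric]\<close>)
  then show ?thesis
    using component_decomposition[of x] by simp
qed

lemma component_sum_homogeneous:
  assumes "\<And>i. f i \<in> gr i"
  shows "component i (\<Sum>i<N. f i) = (if i < N then f i else 0)"
proof -
  show ?thesis
    by (rule component_eqI[where f = "\<lambda>i. if i < N then f i else 0" and J = "{..<N}"])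
       (use assms in auto)
qed

lemma eq_if_components_eq: "(\<And>i. component i x = component i y) \<Longrightarrow> x = y"
  using component_decomposition[of x] component_decomposition[of y] by simp

lemma linear_component: "Vector_Spaces.linear scale scale (component i)"
proof (intro Vector_Spaces.linear_iff[THEN iffD2] conjI allI)
  show "vector_space scale" "vector_space scale"
    by unfold_locales
  fix x y c
  obtain N where x: "x \<in> below N"
    using ex_below by blast
  obtain N' where N': "N' \<ge> N" "y \<in> below N'"
    using ex_below by blast
  have x': "x \<in> below N'"
    using below_mono x N'(1) by blast
  have "x + y = (\<Sum>i<N'. component i x + component i y)"
    using sum_components[OF x'] sum_components[OF N'(2)] by (simp add: sum.distrib)
  then show "component i (x + y) = component i x + component i y"
    by (intro component_eqI[where f = "\<lambda>i. component i x + component i y" and J = "{..<N'}"])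
       (use x' N' in \<open>simp_all add: below_def subspace_add[OF gr_subspace]\<close>)
  have "scale c x = (\<Sum>i<N'. scale c (component i x))"
    using sum_components[OF x'] by (simp flip: scale_sum_right)
  then show "component i (scale c x) = scale c (component i x)"
    by (intro component_eqI[where f = "\<lambda>i. scale c (component i x)" and J = "{..<N'}"])
       (use x' N' in \<open>simp_all add: below_def subspace_scale[OF gr_subspace]\<close>)
qed

lemmas module_hom_component = linear_component[folded module_hom_iff_linear]

lemmas component_simps [simp] =
  module_hom_component[THEN module_hom.add] module_hom_component[THEN module_hom.diff]
  module_hom_component[THEN module_hom.scale] module_hom_component[THEN module_hom.sum]
  module_hom_component[THEN module_hom.zero]

lemma subspace_below: "subspace (below d)"
  and subspace_above: "subspace (above d)"
  by (auto simp: below_def above_def intro!: subspaceI)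

lemma gr_subset_below: "x \<in> gr i \<Longrightarrow> i < d \<Longrightarrow> x \<in> below d"
  and gr_subset_above: "x \<in> gr i \<Longrightarrow> d \<le> i \<Longrightarrow> x \<in> above d"
  by (auto simp: below_def above_def component_homogeneous)

definition truncate :: "nat \<Rightarrow> 'a \<Rightarrow> 'a" where
  "truncate d x = (\<Sum>i<d. component i x)"

text \<open>
  \<open>truncate d\<close> is a linear model of the quotient map modulo \<open>above d\<close>, with \<open>below d\<close> playing the
  role of the quotient space.
\<close>

lemma linear_truncate: "Vector_Spaces.linear scale scale (truncate d)"
  by (intro Vector_Spaces.linear_iff[THEN iffD2] conjI allI)
     (unfold_locales, auto simp: truncate_def sum.distrib scale_sum_right)

lemma truncate_below: "x \<in> below d \<Longrightarrow> truncate d x = x"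
  by (simp add: truncate_def sum_components)

lemma component_truncate: "component i (truncate d x) = (if i < d then component i x else 0)"
  unfolding truncate_def by (rule component_sum_homogeneous) simp

lemma truncate_in_below: "truncate d x \<in> below d"
  by (auto simp: below_def component_truncate)

lemma truncate_eq_0_iff: "truncate d x = 0 \<longleftrightarrow> x \<in> above d"
proof
  assume "truncate d x = 0"
  then have "component i x = 0" if "i < d" for i
    using component_truncate[of i d x] that by simp
  then show "x \<in> above d"
    by (simp add: above_def)
qed (simp add: truncate_def above_def)

text \<open>
  Product and bracket enter the argument in exactly the same way, namely as biadditive operations
  that add degrees, so both are treated at once.
\<close>

definition graded_operation :: "('a \<Rightarrow> 'a \<Rightarrow> 'a) \<Rightarrow> bool" where
  "graded_operation m \<longleftrightarrow>
     (\<forall>x y z. m (x + y) z = m x z + m y z) \<and> (\<forall>x y z. m x (y + z) = m x y + m x z) \<and>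
     (\<forall>i j. \<forall>x\<in>gr i. \<forall>y\<in>gr j. m x y \<in> gr (i + j))"

lemma graded_operation_mult: "graded_operation (*)"
  by (simp add: graded_operation_def gr_mult distrib_left distrib_right)

lemma graded_operation_bracket: "graded_operation bracket"
proof -
  have "bracket (x + y) z = bracket x z + bracket y z"
    and "bracket x (y + z) = bracket x y + bracket x z" for x y z
    using bracket_linear_left bracket_linear_right by (simp_all add: Vector_Spaces.linear_iff)
  then show ?thesis
    by (simp add: graded_operation_def gr_bracket)
qed

lemma graded_operation_zero:
  assumes "graded_operation m"
  shows "m 0 y = 0" "m x 0 = 0"
proof -
  have "m (0 + 0) y = m 0 y + m 0 y" "m x (0 + 0) = m x 0 + m x 0"
    using assms unfolding graded_operation_def by blast+
  then show "m 0 y = 0" "m x 0 = 0"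
    by simp_all
qed

lemma component_operation:
  assumes m: "graded_operation m"
  shows "component n (m x y) = (\<Sum>i\<le>n. m (component i x) (component (n - i) y))"
proof -
  note zero = graded_operation_zero[OF m]
  have left: "m (\<Sum>i\<in>I. f i) z = (\<Sum>i\<in>I. m (f i) z)" if "finite I" for I :: "nat set" and f z
    using that by (induction I) (use m zero in \<open>auto simp: graded_operation_def\<close>)
  have right: "m z (\<Sum>i\<in>I. f i) = (\<Sum>i\<in>I. m z (f i))" if "finite I" for I :: "nat set" and f z
    using that by (induction I) (use m zero in \<open>auto simp: graded_operation_def\<close>)
  obtain K where K: "K \<ge> Suc n" "x \<in> below K"
    using ex_below by blast
  obtain N where N: "N \<ge> K" "y \<in> below N"
    using ex_below by blast
  have x: "x \<in> below N"
    using K N below_mono by blast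
  have "m x y = m (\<Sum>i<N. component i x) (\<Sum>j<N. component j y)"
    by (simp only: sum_components[OF x] sum_components[OF N(2)])
  also have "\<dots> = (\<Sum>i<N. \<Sum>j<N. m (component i x) (component j y))"
    unfolding left[OF finite_lessThan] by (simp only: right[OF finite_lessThan])
  also have "component n \<dots>
      = (\<Sum>i<N. \<Sum>j<N. if i + j = n then m (component i x) (component j y) else 0)"
  proof -
    have "component n (m (component i x) (component j y))
        = (if i + j = n then m (component i x) (component j y) else 0)" for i j
      using m component_homogeneous[of "m (component i x) (component j y)" "i + j" n]
      by (auto simp: graded_operation_def)
    then show ?thesis
      by simp
  qed
  also have "\<dots> = (\<Sum>i<N. if i \<le> n then m (component i x) (component (n - i) y) else 0)"
  proof (rule sum.cong[OF refl])
    fix i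
    have "i + j = n \<longleftrightarrow> i \<le> n \<and> j = n - i" for j
      by auto
    then show "(\<Sum>j<N. if i + j = n then m (component i x) (component j y) else 0)
        = (if i \<le> n then m (component i x) (component (n - i) y) else 0)"
      using K(1) N(1) by auto
  qed
  also have "\<dots> = (\<Sum>i\<in>{..<N} \<inter> {..n}. m (component i x) (component (n - i) y))"
    by (simp add: sum.inter_restrict)
  also have "{..<N} \<inter> {..n} = {..n}"
    using K(1) N(1) by auto
  finally show ?thesis .
qed

text \<open>
  In the convolution formula for degree \<open>i + j\<close>, every summand other than the one of degrees
  \<open>(i, j)\<close> has a factor of too large a degree; dually for \<open>above\<close>, where it has a factor of too
  small a degree. Hence leading components at either end are multiplicative.
\<close>

lemma operation_below:
  assumes m: "graded_operation m" and x: "x \<in> below (Suc i)" and y: "y \<in> below (Suc j)"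
  shows "m x y \<in> below (Suc (i + j))"
    and "component (i + j) (m x y) = m (component i x) (component j y)"
proof -
  note zero = graded_operation_zero[OF m]
  have vanish: "m (component k x) (component (n - k) y) = 0"
    if "n \<ge> i + j" "k \<le> n" "n \<noteq> i + j \<or> k \<noteq> i" for n k
  proof (cases "k \<le> i")
    case True
    with that have "n - k \<ge> Suc j"
      by auto
    then show ?thesis
      using y zero by (simp add: below_def)
  next
    case False
    then show ?thesis
      using x zero by (simp add: below_def)
  qed
  show "m x y \<in> below (Suc (i + j))"
    by (auto simp: below_def component_operation[OF m] intro!: sum.neutral vanish)
  have "(\<Sum>k\<le>i + j. m (component k x) (component (i + j - k) y))
      = (\<Sum>k\<in>{i}. m (component k x) (component (i + j - k) y))"
    by (rule sum.mono_neutral_right) (auto intro!: vanish)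
  then show "component (i + j) (m x y) = m (component i x) (component j y)"
    by (simp add: component_operation[OF m])
qed

lemma operation_above:
  assumes m: "graded_operation m" and x: "x \<in> above i" and y: "y \<in> above j"
  shows "m x y \<in> above (i + j)"
    and "component (i + j) (m x y) = m (component i x) (component j y)"
proof -
  note zero = graded_operation_zero[OF m]
  have vanish: "m (component k x) (component (n - k) y) = 0"
    if "n \<le> i + j" "k \<le> n" "n \<noteq> i + j \<or> k \<noteq> i" for n k
  proof (cases "k < i")
    case True
    then show ?thesis
      using x zero by (simp add: above_def)
  next
    case False
    with that have "n - k < j"
      by auto
    then show ?thesis
      using y zero by (simp add: above_def)
  qed
  show "m x y \<in> above (i + j)"
    by (auto simp: above_def component_operation[OF m] intro!: sum.neutral vanish)
  have "(\<Sum>k\<le>i + j. m (component k x) (component (i + j - k) y))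
      = (\<Sum>k\<in>{i}. m (component k x) (component (i + j - k) y))"
    by (rule sum.mono_neutral_right) (auto intro!: vanish)
  then show "component (i + j) (m x y) = m (component i x) (component j y)"
    by (simp add: component_operation[OF m])
qed

end

context connected_graded_poisson_algebra
begin

lemma one_in_gr_0: "1 \<in> gr 0"
  unfolding gr_0 by (rule range_eqI[of _ _ 1]) simp

text \<open>
  The degree \<open>n\<close> part is spanned by the finitely many words of length \<open>n\<close> in a finite spanning set
  of the degree one part: the words span a subalgebra that contains the generators, and a word of
  length \<open>n\<close> is homogeneous of degree \<open>n\<close>.
\<close>

lemma below_finite_dimensional:
  assumes "fin_gen_in_degree_one"
  shows "\<exists>M. finite M \<and> below d \<subseteq> span M"
proof -
  obtain C where C: "finite C" "span C = gr 1" and gen: "subalgebra hull (gr 1) = UNIV"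
    using assms unfolding fin_gen_in_degree_one_def by blast
  define M where "M n = prod_list ` {xs. set xs \<subseteq> C \<and> length xs = n}" for n
  have fin: "finite (M n)" for n
    unfolding M_def by (intro finite_imageI finite_lists_length_eq C)
  have M_gr: "M n \<subseteq> gr n" for n
  proof -
    have "prod_list xs \<in> gr (length xs)" if "set xs \<subseteq> C" for xs
      using that
    proof (induction xs)
      case Nil
      then show ?case
        by (simp add: one_in_gr_0)
    next
      case (Cons x xs)
      then have "x \<in> gr 1"
        using C(2) span_base by auto
      with Cons show ?case
        using gr_mult[of x 1 "prod_list xs" "length xs"] by simp
    qed
    then show ?thesis
      by (auto simp: M_def)
  qed
  have "subalgebra (span (\<Union>n. M n))"
  proof (rule subalgebra_span)
    have "1 \<in> M 0"
      unfolding M_def by (rule image_eqI[of _ _ "[]"]) auto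
    then show "1 \<in> (\<Union>n. M n)"
      by blast
    fix x y assume "x \<in> (\<Union>n. M n)" "y \<in> (\<Union>n. M n)"
    then obtain xs ys where "x = prod_list xs" "y = prod_list ys" "set xs \<subseteq> C" "set ys \<subseteq> C"
      by (auto simp: M_def)
    then have "x * y = prod_list (xs @ ys)" "set (xs @ ys) \<subseteq> C"
      by auto
    then have "x * y \<in> M (length (xs @ ys))"
      unfolding M_def by blast
    then show "x * y \<in> (\<Union>n. M n)"
      by blast
  qed
  moreover have "gr 1 \<subseteq> span (\<Union>n. M n)"
  proof -
    have "c \<in> M 1" if "c \<in> C" for c
      unfolding M_def by (rule image_eqI[of _ _ "[c]"]) (use that in auto)
    then show ?thesis
      unfolding C(2)[symmetric] by (intro span_mono) auto
  qed
  ultimately have spanning: "span (\<Union>n. M n) = UNIV"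
    using gen hull_minimal[of "gr 1" "span (\<Union>n. M n)" subalgebra] by blast
  have component_in_span: "component i x \<in> span (M i)" for i x
  proof -
    have "x \<in> span (\<Union>n. M n)"
      using spanning by blast
    then show ?thesis
    proof (induction rule: span_induct_alt)
      case base
      then show ?case
        by (simp add: span_zero)
    next
      case (step c x y)
      then obtain n where n: "x \<in> M n"
        by blast
      then have "component i x = (if i = n then x else 0)"
        using M_gr component_homogeneous by blast
      then have "component i x \<in> span (M i)"
        using n by (simp add: span_base span_zero)
      with step show ?case
        by (simp add: span_add span_scale)
    qed
  qed
  have "below d \<subseteq> span (\<Union>n<d. M n)"
  proof
    fix x assume "x \<in> below d"
    then have "x = (\<Sum>i<d. component i x)"
      by (simp add: sum_components)
    moreover have "component i x \<in> span (\<Union>n<d. M n)" if "i < d" for i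
      using component_in_span[of i x] span_mono[of "M i" "\<Union>n<d. M n"] that by blast
    ultimately show "x \<in> span (\<Union>n<d. M n)"
      by (metis (no_types, lifting) lessThan_iff span_sum)
  qed
  then show ?thesis
    using fin by blast
qed

end

section \<open>Gluing isomorphisms of the homogeneous pieces\<close>

locale graded_poisson_pair =
  A: graded_poisson_algebra scaleA bracketA grA + B: graded_poisson_algebra scaleB bracketB grB
  for scaleA :: "'k::field \<Rightarrow> 'a::comm_ring_1 \<Rightarrow> 'a" and bracketA grA
    and scaleB :: "'k \<Rightarrow> 'b::comm_ring_1 \<Rightarrow> 'b" and bracketB grB
begin

text \<open>
  The glued map is determined by its components, so all identities are checked degree by degree;
  for products and brackets this compares the two convolution formulas.
\<close>

lemma graded_poisson_iso_glue:
  fixes t :: "nat \<Rightarrow> 'a \<Rightarrow> 'b"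
  assumes bij: "\<And>i. bij_betw (t i) (grA i) (grB i)"
    and add: "\<And>i x y. x \<in> grA i \<Longrightarrow> y \<in> grA i \<Longrightarrow> t i (x + y) = t i x + t i y"
    and scale: "\<And>i c x. x \<in> grA i \<Longrightarrow> t i (scaleA c x) = scaleB c (t i x)"
    and one: "1 \<in> grA 0" "t 0 1 = 1"
    and mult: "\<And>i j x y. x \<in> grA i \<Longrightarrow> y \<in> grA j \<Longrightarrow> t (i + j) (x * y) = t i x * t j y"
    and bracket: "\<And>i j x y. x \<in> grA i \<Longrightarrow> y \<in> grA j \<Longrightarrow>
      t (i + j) (bracketA x y) = bracketB (t i x) (t j y)"
  shows "\<exists>\<psi>. graded_poisson_iso scaleA bracketA grA scaleB bracketB grB \<psi>"
proof -
  have t_gr: "t i x \<in> grB i" if "x \<in> grA i" for i x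
    using bij that bij_betwE by blast
  have t_inj: "x = y" if "x \<in> grA i" "y \<in> grA i" "t i x = t i y" for i x y
    using bij that by (meson bij_betw_imp_inj_on inj_onD)
  have t_zero: "t i 0 = 0" for i
    using add[of 0 i 0] by simp
  have t_sum: "t i (\<Sum>k\<in>K. f k) = (\<Sum>k\<in>K. t i (f k))"
    if "finite K" "\<And>k. k \<in> K \<Longrightarrow> f k \<in> grA i" for i and K :: "nat set" and f
    using that
    by (induction K) (auto simp: t_zero add A.subspace_sum[OF A.gr_subspace])
  define \<psi> where "\<psi> x = (\<Sum>i | A.component i x \<noteq> 0. t i (A.component i x))" for x
  have component_\<psi>: "B.component i (\<psi> x) = t i (A.component i x)" for i x
    by (rule B.component_eqI[OF _ _ _ \<psi>_def])
       (use A.component_decomposition[of x] t_gr t_zero in auto)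
  note eqI = B.eq_if_components_eq
  have \<psi>_operation: "\<psi> (m x y) = m' (\<psi> x) (\<psi> y)"
    if m: "A.graded_operation m" "B.graded_operation m'"
      and tm: "\<And>i j x y. x \<in> grA i \<Longrightarrow> y \<in> grA j \<Longrightarrow> t (i + j) (m x y) = m' (t i x) (t j y)"
    for m m' x y
  proof (rule eqI)
    fix n
    have in_gr: "m (A.component k x) (A.component (n - k) y) \<in> grA n" if "k \<le> n" for k
      using m(1) that A.component_in_gr le_add_diff_inverse[OF that]
      unfolding A.graded_operation_def by metis
    have "t n (m (A.component k x) (A.component (n - k) y))
        = m' (t k (A.component k x)) (t (n - k) (A.component (n - k) y))" if "k \<le> n" for k
      using tm[of "A.component k x" k "A.component (n - k) y" "n - k"] that by simp
    moreover have "t n (\<Sum>k\<le>n. m (A.component k x) (A.component (n - k) y))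
        = (\<Sum>k\<le>n. t n (m (A.component k x) (A.component (n - k) y)))"
      by (rule t_sum) (auto intro: in_gr)
    ultimately show "B.component n (\<psi> (m x y)) = B.component n (m' (\<psi> x) (\<psi> y))"
      by (simp add: component_\<psi> A.component_operation[OF m(1)] B.component_operation[OF m(2)])
  qed
  have lin: "Vector_Spaces.linear scaleA scaleB \<psi>"
  proof (intro Vector_Spaces.linear_iff[THEN iffD2] conjI allI)
    show "vector_space scaleA" "vector_space scaleB"
      by unfold_locales
    show "\<psi> (x + y) = \<psi> x + \<psi> y" for x y
      by (rule eqI) (simp add: component_\<psi> add)
    show "\<psi> (scaleA c x) = scaleB c (\<psi> x)" for c x
      by (rule eqI) (simp add: component_\<psi> scale)
  qed
  have "inj \<psi>"
    by (rule injI, rule A.eq_if_components_eq, rule t_inj)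
       (auto simp flip: component_\<psi>)
  have \<psi>_homogeneous: "\<psi> x = t i x" if "x \<in> grA i" for x i
    by (rule eqI)
       (simp add: component_\<psi> A.component_homogeneous[OF that]
         B.component_homogeneous[OF t_gr[OF that]] t_zero)
  have image: "\<psi> ` grA i = grB i" for i
    using bij[of i] \<psi>_homogeneous by (simp add: bij_betw_def)
  have "surj \<psi>"
  proof -
    interpret \<psi>: Vector_Spaces.linear scaleA scaleB \<psi> by (rule lin)
    have "y \<in> range \<psi>" for y
    proof -
      obtain N where N: "y \<in> B.below N"
        using B.ex_below by blast
      have "B.component i y \<in> range \<psi>" for i
        using image[of i] B.component_in_gr[of i y] by blast
      then have "(\<Sum>i<N. B.component i y) \<in> range \<psi>"
        by (rule B.subspace_sum[OF \<psi>.subspace_image[OF A.subspace_UNIV]])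
      then show ?thesis
        using B.sum_components[OF N] by simp
    qed
    then show ?thesis
      by blast
  qed
  have "poisson_iso scaleA bracketA scaleB bracketB \<psi>"
    unfolding poisson_iso_def
    using lin \<open>inj \<psi>\<close> \<open>surj \<psi>\<close> \<psi>_homogeneous[OF one(1)] one(2)
      \<psi>_operation[OF A.graded_operation_mult B.graded_operation_mult mult]
      \<psi>_operation[OF A.graded_operation_bracket B.graded_operation_bracket bracket]
    by (simp add: bij_def)
  then show ?thesis
    unfolding graded_poisson_iso_def using image by blast
qed

end

section \<open>The two filtrations\<close>

locale connected_graded_poisson_iso =
  graded_poisson_pair scaleA bracketA grA scaleB bracketB grB +
  A: connected_graded_poisson_algebra scaleA bracketA grA +
  B: connected_graded_poisson_algebra scaleB bracketB grB
  for scaleA :: "'k::field \<Rightarrow> 'a::comm_ring_1 \<Rightarrow> 'a" and bracketA grA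
    and scaleB :: "'k \<Rightarrow> 'b::comm_ring_1 \<Rightarrow> 'b" and bracketB grB +
  fixes \<phi> :: "'a \<Rightarrow> 'b"
  assumes iso: "poisson_iso scaleA bracketA scaleB bracketB \<phi>"
    and fin_gen_A: "A.fin_gen_in_degree_one"
    and fin_gen_B: "B.fin_gen_in_degree_one"
begin

sublocale \<phi>: Vector_Spaces.linear scaleA scaleB \<phi>
  using iso by (simp add: poisson_iso_def)

lemma \<phi>_one [simp]: "\<phi> 1 = 1"
  and \<phi>_mult [simp]: "\<phi> (x * y) = \<phi> x * \<phi> y"
  and \<phi>_bracket [simp]: "\<phi> (bracketA x y) = bracketB (\<phi> x) (\<phi> y)"
  and bij_\<phi>: "bij \<phi>"
  using iso by (simp_all add: poisson_iso_def)

text \<open>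
  The hypotheses are symmetric in \<open>A\<close> and \<open>B\<close>; this lets the dimension inequality below be applied
  in both directions.
\<close>

lemma poisson_iso_inv: "poisson_iso scaleB bracketB scaleA bracketA (inv \<phi>)"
proof -
  have eqI: "inv \<phi> y = x" if "\<phi> x = y" for x y
    using that bij_\<phi> by (metis bij_inv_eq_iff)
  have inv [simp]: "\<phi> (inv \<phi> y) = y" for y
    using bij_\<phi> by (meson bij_inv_eq_iff)
  have "Vector_Spaces.linear scaleB scaleA (inv \<phi>)"
    by (intro Vector_Spaces.linear_iff[THEN iffD2] conjI allI)
       (unfold_locales, auto intro!: eqI simp: \<phi>.add \<phi>.scale)
  then show ?thesis
    unfolding poisson_iso_def using bij_\<phi> by (auto intro!: eqI bij_imp_bij_inv)
qed

text \<open>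
  Elements of \<open>bridge d\<close> have a top component in \<open>A\<^sub>d\<close> and, after applying \<open>\<phi>\<close>, a lowest component in
  \<open>B\<^sub>d\<close>; they carry homogeneous elements of \<open>A\<close> to homogeneous elements of \<open>B\<close>. For instance, if \<open>\<phi> x\<close>
  is \<open>1\<close> plus terms of positive degree for some \<open>x \<in> A\<^sub>1\<close>, then \<open>x - 1\<close> is in \<open>bridge 1\<close> although \<open>x\<close>
  is not.
\<close>

definition bridge :: "nat \<Rightarrow> 'a set" where
  "bridge d = A.below (Suc d) \<inter> \<phi> -` B.above d"

lemma one_in_bridge: "1 \<in> bridge 0"
  using A.gr_subset_below[OF A.one_in_gr_0] by (simp add: bridge_def B.above_def)

lemma bridge_mult: "x \<in> bridge i \<Longrightarrow> y \<in> bridge j \<Longrightarrow> x * y \<in> bridge (i + j)"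
  by (simp add: bridge_def A.operation_below[OF A.graded_operation_mult]
      B.operation_above[OF B.graded_operation_mult])

lemma bridge_bracket: "x \<in> bridge i \<Longrightarrow> y \<in> bridge j \<Longrightarrow> bracketA x y \<in> bridge (i + j)"
  by (simp add: bridge_def A.operation_below[OF A.graded_operation_bracket]
      B.operation_above[OF B.graded_operation_bracket])

text \<open>
  Connectedness of \<open>B\<close> and generation of \<open>A\<close> in degree one work together: a generator in \<open>A\<^sub>1\<close> is
  moved into \<open>bridge 1\<close> by subtracting the degree zero component of its image, which is a scalar
  and hence exists in \<open>A\<close> as well.
\<close>

lemma span_bridge: "A.span (\<Union>d. bridge d) = UNIV"
proof -
  have "A.subalgebra (A.span (\<Union>d. bridge d))"
    by (rule A.subalgebra_span) (use one_in_bridge bridge_mult in blast)+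
  moreover have "grA 1 \<subseteq> A.span (\<Union>d. bridge d)"
  proof
    fix x assume x: "x \<in> grA 1"
    obtain c where c: "B.component 0 (\<phi> x) = scaleB c 1"
      using B.component_in_gr[of 0 "\<phi> x"] unfolding B.gr_0 by blast
    define v where "v = x - scaleA c 1"
    have "v \<in> A.below 2"
      unfolding v_def
      using A.gr_subset_below[OF x, of 2] A.gr_subset_below[OF A.one_in_gr_0, of 2]
      by (auto intro!: A.subspace_diff[OF A.subspace_below] A.subspace_scale[OF A.subspace_below])
    moreover have "\<phi> v \<in> B.above 1"
      by (simp add: v_def \<phi>.diff \<phi>.scale B.above_def c B.component_homogeneous[OF B.one_in_gr_0])
    ultimately have "v \<in> bridge 1"
      by (simp add: bridge_def numeral_2_eq_2)
    then have "v + scaleA c 1 \<in> A.span (\<Union>d. bridge d)"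
      using one_in_bridge by (intro A.span_add A.span_scale A.span_base) blast+
    then show "x \<in> A.span (\<Union>d. bridge d)"
      by (simp add: v_def)
  qed
  ultimately show ?thesis
    using fin_gen_A hull_minimal[of "grA 1" "A.span (\<Union>d. bridge d)" A.subalgebra]
    unfolding A.fin_gen_in_degree_one_def by blast
qed

text \<open>
  \<open>bridge n\<close> lies in the first summand if \<open>n < d\<close> and in the second one otherwise.
\<close>

lemma below_plus_above: "\<exists>f g. x = f + g \<and> f \<in> A.below d \<and> \<phi> g \<in> B.above d"
proof -
  have "x \<in> A.span (\<Union>d. bridge d)"
    by (simp add: span_bridge)
  then show ?thesis
  proof (induction rule: A.span_induct_alt)
    case base
    show ?case
      by (intro exI[of _ 0]) (simp add: A.below_def B.above_def \<phi>.zero)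
  next
    case (step c w y)
    then obtain f g n where fg: "y = f + g" "f \<in> A.below d" "\<phi> g \<in> B.above d"
      and w: "w \<in> bridge n"
      by blast
    show ?case
    proof (cases "n < d")
      case True
      then have "w \<in> A.below d"
        using w A.below_mono by (auto simp: bridge_def)
      with fg show ?thesis
        by (intro exI[of _ "scaleA c w + f"] exI[of _ g])
           (auto intro!: A.subspace_add[OF A.subspace_below] A.subspace_scale[OF A.subspace_below])
    next
      case False
      then have "\<phi> w \<in> B.above d"
        using w by (auto simp: bridge_def B.above_def)
      with fg show ?thesis
        by (intro exI[of _ f] exI[of _ "scaleA c w + g"])
           (auto simp: \<phi>.add \<phi>.scale algebra_simps
             intro!: B.subspace_add[OF B.subspace_above] B.subspace_scale[OF B.subspace_above])
    qed
  qed
qed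

lemma linear_truncate_\<phi>: "Vector_Spaces.linear scaleA scaleB (B.truncate d \<circ> \<phi>)"
  using Vector_Spaces.linear_compose[OF \<phi>.linear_axioms B.linear_truncate] .

text \<open>
  Modulo \<open>B\<^sub>\<ge>\<^sub>d\<close>, the summand with image in \<open>B\<^sub>\<ge>\<^sub>d\<close> disappears, so \<open>A\<^sub><\<^sub>d\<close> already hits everything.
\<close>

lemma truncate_\<phi>_image: "(B.truncate d \<circ> \<phi>) ` A.below d = B.below d"
proof
  show "(B.truncate d \<circ> \<phi>) ` A.below d \<subseteq> B.below d"
    using B.truncate_in_below by auto
  show "B.below d \<subseteq> (B.truncate d \<circ> \<phi>) ` A.below d"
  proof
    fix y assume y: "y \<in> B.below d"
    obtain x where x: "y = \<phi> x"
      using bij_\<phi> by (meson bij_pointE)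
    obtain f g where fg: "x = f + g" "f \<in> A.below d" "\<phi> g \<in> B.above d"
      using below_plus_above by blast
    interpret T: Vector_Spaces.linear scaleA scaleB "B.truncate d \<circ> \<phi>"
      by (rule linear_truncate_\<phi>)
    have "y = (B.truncate d \<circ> \<phi>) x"
      using B.truncate_below[OF y] x by simp
    also have "\<dots> = (B.truncate d \<circ> \<phi>) f + (B.truncate d \<circ> \<phi>) g"
      unfolding fg(1) by (rule T.add)
    also have "(B.truncate d \<circ> \<phi>) g = 0"
      using fg(3) by (simp add: B.truncate_eq_0_iff)
    finally show "y \<in> (B.truncate d \<circ> \<phi>) ` A.below d"
      using fg(2) by simp
  qed
qed

lemma dim_below_le: "B.dim (B.below d) \<le> A.dim (A.below d)"
proof -
  obtain M where "finite M" "A.below d \<subseteq> A.span M"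
    using A.below_finite_dimensional[OF fin_gen_A] by blast
  then have "B.dim ((B.truncate d \<circ> \<phi>) ` A.below d) \<le> A.dim (A.below d)"
    by (intro dim_image_le[OF linear_truncate_\<phi>])
  then show ?thesis
    by (simp only: truncate_\<phi>_image)
qed

lemma dim_below_eq: "A.dim (A.below d) = B.dim (B.below d)"
proof -
  interpret swapped:
    connected_graded_poisson_iso scaleB bracketB grB scaleA bracketA grA "inv \<phi>"
    by unfold_locales (rule poisson_iso_inv fin_gen_A fin_gen_B)+
  show ?thesis
    using dim_below_le swapped.dim_below_le by (simp add: order_antisym)
qed

text \<open>
  A nonzero element of the intersection would be a kernel vector of the surjection from \<open>A\<^sub><\<^sub>d\<close> to
  \<open>B\<^sub><\<^sub>d\<close>, making the dimension drop.
\<close>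

lemma below_inter_above:
  assumes x: "x \<in> A.below d" and "\<phi> x \<in> B.above d"
  shows "x = 0"
proof (rule ccontr)
  assume "x \<noteq> 0"
  obtain M where M: "finite M" "A.below d \<subseteq> A.span M"
    using A.below_finite_dimensional[OF fin_gen_A] by blast
  have "B.dim ((B.truncate d \<circ> \<phi>) ` A.below d) < A.dim (A.below d)"
    using assms \<open>x \<noteq> 0\<close>
    by (intro dim_image_less_of_kernel[OF linear_truncate_\<phi> M(2,1)])
       (auto simp: B.truncate_eq_0_iff)
  then show False
    by (simp only: truncate_\<phi>_image dim_below_eq less_irrefl)
qed

section \<open>The graded isomorphism\<close>

lemma subspace_bridge: "A.subspace (bridge d)"
  unfolding bridge_def
  by (intro A.subspace_inter A.subspace_below \<phi>.subspace_vimage B.subspace_above)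

text \<open>
  The next four facts say that \<open>bridge d\<close> is isomorphic to \<open>A\<^sub>d\<close> and to \<open>B\<^sub>d\<close>. Injectivity: an element
  whose leading component vanishes moves one step down in the filtration of \<open>A\<close>, or one step up in
  that of \<open>B\<close>, and so falls into a trivial intersection. Surjectivity: a homogeneous element is split
  along \<open>below_plus_above\<close>, and one of the two parts differs from it only in degrees that do not affect
  the leading component. For \<open>A\<close> the splitting is at \<open>d\<close>, for \<open>B\<close> at \<open>Suc d\<close>.
\<close>

lemma bridge_component_A_inj:
  assumes "w \<in> bridge d" "A.component d w = 0"
  shows "w = 0"
proof (rule below_inter_above)
  show "w \<in> A.below d"
    using assms by (auto simp: bridge_def A.below_def le_eq_less_or_eq[of d] Suc_le_eq)
  show "\<phi> w \<in> B.above d"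
    using assms by (simp add: bridge_def)
qed

lemma bridge_component_B_inj:
  assumes "w \<in> bridge d" "B.component d (\<phi> w) = 0"
  shows "w = 0"
proof (rule below_inter_above)
  show "w \<in> A.below (Suc d)"
    using assms by (simp add: bridge_def)
  show "\<phi> w \<in> B.above (Suc d)"
    using assms by (auto simp: bridge_def B.above_def less_Suc_eq)
qed

lemma bridge_component_A_surj:
  assumes a: "a \<in> grA d"
  shows "\<exists>w\<in>bridge d. A.component d w = a"
proof -
  obtain f g where fg: "a = f + g" "f \<in> A.below d" "\<phi> g \<in> B.above d"
    using below_plus_above by blast
  have g: "g = a - f"
    using fg(1) by simp
  have "g \<in> A.below (Suc d)"
    unfolding g using A.gr_subset_below[OF a] A.below_mono[OF fg(2)]
    by (intro A.subspace_diff[OF A.subspace_below]) auto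
  moreover have "A.component d g = a"
    using fg(2) by (simp add: g A.component_homogeneous[OF a] A.below_def)
  ultimately show ?thesis
    using fg(3) by (auto simp: bridge_def)
qed

lemma bridge_component_B_surj:
  assumes b: "b \<in> grB d"
  shows "\<exists>w\<in>bridge d. B.component d (\<phi> w) = b"
proof -
  obtain x where x: "b = \<phi> x"
    using bij_\<phi> by (meson bij_pointE)
  obtain f g where fg: "x = f + g" "f \<in> A.below (Suc d)" "\<phi> g \<in> B.above (Suc d)"
    using below_plus_above by blast
  have f: "\<phi> f = b - \<phi> g"
    using fg(1) x by (simp add: \<phi>.add)
  have "\<phi> f \<in> B.above d"
    unfolding f using B.gr_subset_above[OF b] fg(3)
    by (intro B.subspace_diff[OF B.subspace_above]) (auto simp: B.above_def)
  moreover have "B.component d (\<phi> f) = b"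
    using fg(3) by (simp add: f B.component_homogeneous[OF b] B.above_def)
  ultimately show ?thesis
    using fg(2) by (auto simp: bridge_def)
qed

definition piece :: "nat \<Rightarrow> 'a \<Rightarrow> 'b" where
  "piece d a = B.component d (\<phi> (SOME w. w \<in> bridge d \<and> A.component d w = a))"

text \<open>
  Since the element chosen in \<open>piece\<close> is unique, every property of \<open>piece\<close> can be read off from any
  convenient element of \<open>bridge d\<close>.
\<close>

lemma piece_component:
  assumes w: "w \<in> bridge d"
  shows "piece d (A.component d w) = B.component d (\<phi> w)"
proof -
  define v where "v = (SOME v. v \<in> bridge d \<and> A.component d v = A.component d w)"
  have v: "v \<in> bridge d \<and> A.component d v = A.component d w"
    unfolding v_def
    by (rule someI[where P = "\<lambda>v. v \<in> bridge d \<and> A.component d v = A.component d w"])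
       (use w in simp)
  have "v - w = 0"
  proof (rule bridge_component_A_inj)
    show "v - w \<in> bridge d"
      using v w by (blast intro: A.subspace_diff[OF subspace_bridge])
    show "A.component d (v - w) = 0"
      using v by simp
  qed
  then show ?thesis
    unfolding piece_def v_def[symmetric] by simp
qed

lemma ex_graded_poisson_iso:
  "\<exists>\<psi>. graded_poisson_iso scaleA bracketA grA scaleB bracketB grB \<psi>"
proof (rule graded_poisson_iso_glue[of piece])
  note lift = bridge_component_A_surj
  show "bij_betw (piece d) (grA d) (grB d)" for d
  proof (rule bij_betw_imageI)
    show "inj_on (piece d) (grA d)"
    proof (rule inj_onI)
      fix x y assume xy: "x \<in> grA d" "y \<in> grA d" "piece d x = piece d y"
      obtain v w where v: "v \<in> bridge d" "A.component d v = x"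
        and w: "w \<in> bridge d" "A.component d w = y"
        using lift xy(1,2) by blast
      have "B.component d (\<phi> (v - w)) = 0"
        using xy(3) piece_component v w by (auto simp: \<phi>.diff)
      with A.subspace_diff[OF subspace_bridge v(1) w(1)] have "v - w = 0"
        by (rule bridge_component_B_inj)
      then show "x = y"
        using v w by auto
    qed
    show "piece d ` grA d = grB d"
    proof
      show "piece d ` grA d \<subseteq> grB d"
        by (auto simp: piece_def)
      show "grB d \<subseteq> piece d ` grA d"
      proof
        fix b assume "b \<in> grB d"
        then obtain w where "w \<in> bridge d" "B.component d (\<phi> w) = b"
          using bridge_component_B_surj by blast
        then show "b \<in> piece d ` grA d"
          using piece_component A.component_in_gr by (metis imageI)
      qed
    qed
  qed
  show "piece d (x + y) = piece d x + piece d y" if xy: "x \<in> grA d" "y \<in> grA d" for d x y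
  proof -
    obtain v w where "v \<in> bridge d" "A.component d v = x" "w \<in> bridge d" "A.component d w = y"
      using lift xy by blast
    then show ?thesis
      using piece_component[of "v + w" d] A.subspace_add[OF subspace_bridge] piece_component
      by (auto simp: \<phi>.add)
  qed
  show "piece d (scaleA c x) = scaleB c (piece d x)" if x: "x \<in> grA d" for d c x
  proof -
    obtain w where "w \<in> bridge d" "A.component d w = x"
      using lift x by blast
    then show ?thesis
      using piece_component[of "scaleA c w" d] A.subspace_scale[OF subspace_bridge] piece_component
      by (auto simp: \<phi>.scale)
  qed
  show "1 \<in> grA 0"
    by (rule A.one_in_gr_0)
  show "piece 0 1 = 1"
    using piece_component[OF one_in_bridge]
    by (simp add: A.component_homogeneous[OF A.one_in_gr_0] B.component_homogeneous[OF B.one_in_gr_0])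
  show "piece (i + j) (x * y) = piece i x * piece j y" if xy: "x \<in> grA i" "y \<in> grA j" for i j x y
  proof -
    obtain v w where v: "v \<in> bridge i" "A.component i v = x"
      and w: "w \<in> bridge j" "A.component j w = y"
      using lift xy by meson
    then have "A.component (i + j) (v * w) = x * y"
      by (simp add: bridge_def A.operation_below[OF A.graded_operation_mult])
    moreover have "B.component (i + j) (\<phi> (v * w)) = B.component i (\<phi> v) * B.component j (\<phi> w)"
      using v w by (simp add: bridge_def B.operation_above[OF B.graded_operation_mult])
    ultimately show ?thesis
      using piece_component[OF bridge_mult[OF v(1) w(1)]] piece_component v w by auto
  qed
  show "piece (i + j) (bracketA x y) = bracketB (piece i x) (piece j y)"
    if xy: "x \<in> grA i" "y \<in> grA j" for i j x y
  proof -
    obtain v w where v: "v \<in> bridge i" "A.component i v = x"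
      and w: "w \<in> bridge j" "A.component j w = y"
      using lift xy by meson
    then have "A.component (i + j) (bracketA v w) = bracketA x y"
      by (simp add: bridge_def A.operation_below[OF A.graded_operation_bracket])
    moreover have "B.component (i + j) (\<phi> (bracketA v w))
        = bracketB (B.component i (\<phi> v)) (B.component j (\<phi> w))"
      using v w by (simp add: bridge_def B.operation_above[OF B.graded_operation_bracket])
    ultimately show ?thesis
      using piece_component[OF bridge_bracket[OF v(1) w(1)]] piece_component v w by auto
  qed
qed

end

theorem theorem1p3:
  fixes scaleA :: "'k::field \<Rightarrow> 'a::comm_ring_1 \<Rightarrow> 'a"
    and bracketA :: "'a \<Rightarrow> 'a \<Rightarrow> 'a" and grA :: "nat \<Rightarrow> 'a set"
    and scaleB :: "'k \<Rightarrow> 'b::comm_ring_1 \<Rightarrow> 'b"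
    and bracketB :: "'b \<Rightarrow> 'b \<Rightarrow> 'b" and grB :: "nat \<Rightarrow> 'b set"
  assumes "connected_graded_poisson_algebra scaleA bracketA grA"
    and "graded_poisson_algebra.fin_gen_in_degree_one scaleA grA"
    and "connected_graded_poisson_algebra scaleB bracketB grB"
    and "graded_poisson_algebra.fin_gen_in_degree_one scaleB grB"
    and "\<exists>\<phi>. poisson_iso scaleA bracketA scaleB bracketB \<phi>"
  shows "\<exists>\<psi>. graded_poisson_iso scaleA bracketA grA scaleB bracketB grB \<psi>"
proof -
  obtain \<phi> where iso: "poisson_iso scaleA bracketA scaleB bracketB \<phi>"
    using assms(5) by blast
  interpret A: connected_graded_poisson_algebra scaleA bracketA grA
    by (rule assms(1))
  interpret B: connected_graded_poisson_algebra scaleB bracketB grB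
    by (rule assms(3))
  interpret connected_graded_poisson_iso scaleA bracketA grA scaleB bracketB grB \<phi>
    by unfold_locales (rule iso assms(2) assms(4))+
  show ?thesis
    by (rule ex_graded_poisson_iso)
qed

end
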